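(* Let $k\ge2$ be an integer, $X$ uniformly distributed over $[0,1)$, and consider the toy model $\mathcal{U}_k^{\mathtt{toy}}$. For any $x\in[\frac1k,1-\frac1k]$, the expected infinite forest at $x$, $\tilde s_\infty(x):=\mathbb{E}_{\mathbb{U}\sim\mathcal{U}_k^{\mathtt{toy}}}[\tilde s_{\mathbb{U}}(x)]$, satisfies $$\tilde s_\infty(x)=\int_0^1 s(t)\,h(t-x)\,dt,$$ where $$h(u)=\begin{cases}k(1-ku)&\text{if }0\le u\le\frac1k,\\ k(1+ku)&\text{if }-\frac1k\le u\le0,\\ 0&\text{if }|u|\ge\frac1k.\end{cases}$$
   Context: $\mathcal{X}=[0,1)$ and $s:\mathcal{X}\to\mathbb{R}$ is measurable (and integrable). $\mathbb{U}\sim\mathcal{U}_k^{\mathtt{toy}}$ means $$\mathbb{U}=\Big\{\big[0,\tfrac{1-T}{k}\big),\big[\tfrac{1-T}{k},\tfrac{2-T}{k}\big),\dots,\big[\tfrac{k-T}{k},1\big)\Big\}$$ with $T$ uniform over $[0,1)$. For a partition $\mathbb{U}$ of $[0,1)$ into intervals and $x\in[0,1)$, $I_{\mathbb{U}}(x)$ is the cell containing $x$ and (since $X$ is uniform) $\tilde s_{\mathbb{U}}(x)=\mathbb{E}[s(X)\mid X\in I_{\mathbb{U}}(x)]=\frac1{|I_{\mathbb{U}}(x)|}\int_{I_{\mathbb{U}}(x)}s(t)\,dt$. *)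

theory Defs
  imports "HOL-Probability.Probability"
begin

text \<open>The uniform distribution on the half-open unit interval: it has total mass 1.\<close>

definition unif01 :: "real measure" where
  "unif01 = restrict_space lborel {0..<1}"

lemma space_unif01 [simp]: "space unif01 = {0..<1}"
  by (simp add: unif01_def space_restrict_space)

lemma prob_space_unif01: "prob_space unif01"
  by (rule prob_spaceI) (simp add: unif01_def space_restrict_space emeasure_restrict_space)

text \<open>For \<^term>\<open>T = 0\<close> the last cell is empty; this is harmless, as it contains no point
  (and the event has probability 0).\<close>

definition toy_partition :: "nat \<Rightarrow> real \<Rightarrow> real set set" where
  "toy_partition k T =
     {{0..<(1 - T) / real k}}
     \<union> {{(real i - T) / real k..<(real i + 1 - T) / real k} |i. i \<in> {1..<k}}
     \<union> {{(real k - T) / real k..<1}}"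

text \<open>The law of the random partition. Sets of partitions carry the largest sigma-algebra that makes
  the map from the shift to the partition measurable, so that expectations with respect to this
  law are exactly expectations over the shift (see the lemmas below).\<close>

definition toy_space :: "nat \<Rightarrow> real set set measure" where
  "toy_space k = sigma UNIV {A. toy_partition k -` A \<inter> {0..<1} \<in> sets unif01}"

definition toy_model :: "nat \<Rightarrow> real set set measure" where
  "toy_model k = distr unif01 (toy_space k) (toy_partition k)"

lemma sets_toy_space: "sets (toy_space k) = {A. toy_partition k -` A \<inter> {0..<1} \<in> sets unif01}"
proof -
  have "sigma_algebra UNIV {A. toy_partition k -` A \<inter> {0..<1} \<in> sets unif01}"
  proof (unfold sigma_algebra_iff2, intro conjI ballI allI impI)
    fix A assume "A \<in> {A. toy_partition k -` A \<inter> {0..<1} \<in> sets unif01}"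
    then have "space unif01 - (toy_partition k -` A \<inter> {0..<1}) \<in> sets unif01"
      by blast
    moreover have "space unif01 - (toy_partition k -` A \<inter> {0..<1})
        = toy_partition k -` (UNIV - A) \<inter> {0..<1}"
      by auto
    ultimately show "UNIV - A \<in> {A. toy_partition k -` A \<inter> {0..<1} \<in> sets unif01}" by simp
  next
    fix F :: "nat \<Rightarrow> real set set set"
    assume "range F \<subseteq> {A. toy_partition k -` A \<inter> {0..<1} \<in> sets unif01}"
    then have "(\<Union>i. toy_partition k -` F i \<inter> {0..<1}) \<in> sets unif01" by blast
    moreover have "(\<Union>i. toy_partition k -` F i \<inter> {0..<1})
        = toy_partition k -` (\<Union>i. F i) \<inter> {0..<1}"
      by auto
    ultimately show "(\<Union>i. F i) \<in> {A. toy_partition k -` A \<inter> {0..<1} \<in> sets unif01}" by simp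
  qed auto
  then show ?thesis
    by (simp add: toy_space_def sigma_algebra.sigma_sets_eq)
qed

lemma space_toy_space [simp]: "space (toy_space k) = UNIV"
  by (simp add: toy_space_def)

lemma measurable_toy_partition: "toy_partition k \<in> measurable unif01 (toy_space k)"
  by (auto simp: measurable_def sets_toy_space)

lemma borel_measurable_toy_space_iff:
  fixes f :: "real set set \<Rightarrow> real"
  shows "f \<in> borel_measurable (toy_space k) \<longleftrightarrow>
         (\<lambda>T. f (toy_partition k T)) \<in> borel_measurable unif01"
proof -
  have "toy_partition k -` (f -` B) = (\<lambda>T. f (toy_partition k T)) -` B" for B
    by auto
  then show ?thesis
    by (simp add: measurable_def sets_toy_space)
qed

lemma prob_space_toy_model: "prob_space (toy_model k)"
  unfolding toy_model_def
  by (rule prob_space.prob_space_distr[OF prob_space_unif01 measurable_toy_partition])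

lemma integrable_toy_model_iff:
  fixes f :: "real set set \<Rightarrow> real"
  shows "integrable (toy_model k) f \<longleftrightarrow> integrable unif01 (\<lambda>T. f (toy_partition k T))"
proof (cases "f \<in> borel_measurable (toy_space k)")
  case True
  then show ?thesis
    unfolding toy_model_def by (rule integrable_distr_eq[OF measurable_toy_partition])
next
  case False
  then show ?thesis
    by (auto simp: integrable_iff_bounded toy_model_def borel_measurable_toy_space_iff)
qed

lemma integral_toy_model:
  fixes f :: "real set set \<Rightarrow> real"
  shows "(\<integral>U. f U \<partial>toy_model k) = (\<integral>T. f (toy_partition k T) \<partial>unif01)"
proof (cases "f \<in> borel_measurable (toy_space k)")
  case True
  then show ?thesis
    unfolding toy_model_def by (rule integral_distr[OF measurable_toy_partition])
next
  case False
  then have "\<not> integrable unif01 (\<lambda>T. f (toy_partition k T))"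
    by (auto simp: borel_measurable_toy_space_iff dest: borel_measurable_integrable)
  then show ?thesis
    by (simp add: not_integrable_integral_eq integrable_toy_model_iff)
qed

definition cell :: "real set set \<Rightarrow> real \<Rightarrow> real set" where
  "cell U x = (THE I. I \<in> U \<and> x \<in> I)"

text \<open>The conditional expectation of \<^term>\<open>Y\<close> given an event \<^term>\<open>A\<close> of positive probability,
  i.e. the expectation under the conditional probability measure given \<^term>\<open>A\<close>.\<close>

definition cond_expectation :: "'a measure \<Rightarrow> ('a \<Rightarrow> real) \<Rightarrow> 'a set \<Rightarrow> real" where
  "cond_expectation M Y A = (\<integral>\<omega>. Y \<omega> \<partial>uniform_measure M A)"

definition tree_approx ::
    "'a measure \<Rightarrow> ('a \<Rightarrow> real) \<Rightarrow> (real \<Rightarrow> real) \<Rightarrow> real set set \<Rightarrow> real \<Rightarrow> real" where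
  "tree_approx M X s U x =
     cond_expectation M (\<lambda>\<omega>. s (X \<omega>)) {\<omega> \<in> space M. X \<omega> \<in> cell U x}"

definition infinite_forest ::
    "'a measure \<Rightarrow> ('a \<Rightarrow> real) \<Rightarrow> (real \<Rightarrow> real) \<Rightarrow> real set set measure \<Rightarrow> real \<Rightarrow> real" where
  "infinite_forest M X s \<U> x = (\<integral>U. tree_approx M X s U x \<partial>\<U>)"

definition toy_kernel :: "nat \<Rightarrow> real \<Rightarrow> real" where
  "toy_kernel k u =
     (if 0 \<le> u \<and> u \<le> 1 / real k then real k * (1 - real k * u)
      else if - (1 / real k) \<le> u \<and> u \<le> 0 then real k * (1 + real k * u)
      else 0)"

end

theory Submission
  imports Defs
begin

text \<open>
  Since \<open>1 / k \<le> x \<le> 1 - 1 / k\<close>, the cell containing \<open>x\<close> is for every shift \<open>T\<close> one of the cells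
  of full length \<open>1 / k\<close>. Writing \<open>r = frac (k * x + T)\<close> for the relative position of \<open>x\<close> in it, the
  cell is \<open>[x - r / k, x + (1 - r) / k)\<close> (\<open>cell_toy_partition\<close>), so the tree at \<open>x\<close> is \<open>k\<close> times the
  integral of \<open>s\<close> over this interval.

  If \<open>T\<close> is uniform on \<open>[0, 1)\<close>, then so is \<open>r\<close>, because the uniform law is invariant under rotations
  of the circle (\<open>distr_unif01_frac_add\<close>). After exchanging the expectation over \<open>r\<close> with the
  integral over \<open>t\<close>, the weight of \<open>s t\<close> is \<open>k\<close> times the probability that \<open>t\<close> lies in the random
  cell. With \<open>u = t - x\<close>, this is the probability that \<open>- k * u \<le> r < 1 - k * u\<close>, namely
  \<open>max 0 (1 - k * \<bar>u\<bar>)\<close>, which gives the triangular kernel (\<open>toy_kernel_eq_prob\<close>).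
\<close>

lemma sets_unif01_iff: "A \<in> sets unif01 \<longleftrightarrow> A \<in> sets borel \<and> A \<subseteq> {0..<1}"
  unfolding unif01_def by (subst sets_restrict_space_iff) auto

lemma emeasure_unif01: "A \<subseteq> {0..<1} \<Longrightarrow> emeasure unif01 A = emeasure lborel A"
  unfolding unif01_def by (subst emeasure_restrict_space) auto

lemma borel_measurable_unif01: "f \<in> borel_measurable borel \<Longrightarrow> f \<in> borel_measurable unif01"
  unfolding unif01_def by (rule measurable_restrict_space1) simp

lemma integral_unif01:
  fixes f :: "real \<Rightarrow> real"
  shows "integral\<^sup>L unif01 f = (LBINT t=0..1. f t)"
proof -
  have "(LBINT t=ereal 0..ereal 1. f t) = (LBINT t:{0..<1}. f t)"
    by (rule interval_integral_Ico) simp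
  then show ?thesis
    by (simp add: unif01_def integral_restrict_space set_lebesgue_integral_def
        zero_ereal_def one_ereal_def)
qed

lemma emeasure_lborel_vimage_plus:
  fixes c :: real
  assumes "A \<in> sets borel"
  shows "emeasure lborel ((+) c -` A) = emeasure lborel A"
proof -
  have "emeasure (distr lborel borel ((+) c)) A = emeasure lborel ((+) c -` A)"
    using assms by (subst emeasure_distr) auto
  then show ?thesis
    by (simp add: lborel_distr_plus)
qed

lemma frac_add_measurable_unif01:
  "(\<lambda>T. frac (a + T)) \<in> measurable unif01 unif01"
proof -
  have "(\<lambda>T. frac (a + T)) \<in> measurable unif01 borel"
    unfolding frac_def by (intro borel_measurable_unif01) measurable
  then show ?thesis
    unfolding unif01_def by (intro measurable_restrict_space2) (auto simp: frac_lt_1)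
qed

text \<open>Rotations of the circle \<open>\<real> / \<int>\<close>, represented by \<open>[0, 1)\<close>, preserve the uniform law.\<close>

lemma distr_unif01_frac_add: "distr unif01 unif01 (\<lambda>T. frac (a + T)) = unif01"
proof (rule measure_eqI)
  fix A assume "A \<in> sets (distr unif01 unif01 (\<lambda>T. frac (a + T)))"
  then have A: "A \<in> sets unif01" and [measurable]: "A \<in> sets borel" and A01: "A \<subseteq> {0..<1}"
    by (auto simp: sets_unif01_iff)
  define f where "f = frac a"
  have f: "0 \<le> f" "f < 1"
    by (auto simp: f_def frac_lt_1)
  have frac_eq: "frac (a + T) = (if f + T < 1 then f + T else f - 1 + T)" if "T \<in> {0..<1}" for T
    using that by (simp add: frac_add f_def)
  let ?P = "(+) f -` (A \<inter> {f..<1})" and ?Q = "(+) (f - 1) -` (A \<inter> {0..<f})"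
  \<comment> \<open>The preimage splits according to whether the rotation wraps around.\<close>
  have split: "(\<lambda>T. frac (a + T)) -` A \<inter> {0..<1} = ?P \<union> ?Q"
  proof (intro set_eqI)
    fix T show "T \<in> (\<lambda>T. frac (a + T)) -` A \<inter> {0..<1} \<longleftrightarrow> T \<in> ?P \<union> ?Q"
      using f A01 frac_eq[of T] by (cases "f + T < 1"; cases "T \<in> {0..<1}") auto
  qed
  have meas: "?P \<in> sets lborel" "?Q \<in> sets lborel"
    using measurable_sets[of "(+) f" borel borel "A \<inter> {f..<1}"]
      measurable_sets[of "(+) (f - 1)" borel borel "A \<inter> {0..<f}"] by auto
  have "emeasure (distr unif01 unif01 (\<lambda>T. frac (a + T))) A
      = emeasure unif01 ((\<lambda>T. frac (a + T)) -` A \<inter> {0..<1})"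
    using A by (simp add: emeasure_distr frac_add_measurable_unif01)
  also have "\<dots> = emeasure lborel (?P \<union> ?Q)"
    unfolding split[symmetric] by (rule emeasure_unif01) simp
  also have "\<dots> = emeasure lborel ?P + emeasure lborel ?Q"
    using meas by (intro plus_emeasure[symmetric]) auto
  also have "\<dots> = emeasure lborel (A \<inter> {f..<1}) + emeasure lborel (A \<inter> {0..<f})"
    by (intro arg_cong2[where f = "(+)"] emeasure_lborel_vimage_plus) auto
  also have "\<dots> = emeasure lborel ((A \<inter> {f..<1}) \<union> (A \<inter> {0..<f}))"
    by (intro plus_emeasure) auto
  also have "(A \<inter> {f..<1}) \<union> (A \<inter> {0..<f}) = A"
    using A01 f by force
  finally show "emeasure (distr unif01 unif01 (\<lambda>T. frac (a + T))) A = emeasure unif01 A"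
    using A01 by (simp add: emeasure_unif01)
qed simp

lemma cond_expectation_eq:
  assumes "prob_space M" and A: "A \<in> sets M" and Y: "Y \<in> borel_measurable M"
    and pos: "measure M A > 0"
  shows "cond_expectation M Y A = (\<integral>\<omega>. indicator A \<omega> * Y \<omega> \<partial>M) / measure M A"
proof -
  interpret prob_space M by fact
  have "indicator A \<omega> / emeasure M A = ennreal (indicator A \<omega> / prob A)" for \<omega>
    using pos by (auto simp: emeasure_eq_measure divide_ennreal split: split_indicator
        simp flip: ennreal_1)
  then have "uniform_measure M A = density M (\<lambda>\<omega>. ennreal (indicator A \<omega> / prob A))"
    by (simp add: uniform_measure_def)
  then have "cond_expectation M Y A = (\<integral>\<omega>. (indicator A \<omega> / prob A) *\<^sub>R Y \<omega> \<partial>M)"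
    unfolding cond_expectation_def using A Y by (simp add: integral_density)
  also have "\<dots> = (\<integral>\<omega>. (indicator A \<omega> * Y \<omega>) / prob A \<partial>M)"
    by simp
  finally show ?thesis
    by (simp only: integral_divide_zero)
qed

text \<open>For a uniform \<open>X\<close>, the tree is the mean value of \<open>s\<close> over the cell.\<close>

lemma tree_approx_eq:
  assumes M: "prob_space M" and X: "X \<in> measurable M unif01" and distr: "distr M unif01 X = unif01"
    and s: "s \<in> borel_measurable unif01"
    and cell: "cell U x = {a..<b}" and ab: "0 \<le> a" "a < b" "b \<le> 1"
  shows "tree_approx M X s U x = (\<integral>t. indicator {a..<b} t * s t \<partial>unif01) / (b - a)"
proof -
  let ?A = "{\<omega> \<in> space M. X \<omega> \<in> {a..<b}}"
  have I: "{a..<b} \<in> sets unif01"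
    using ab by (auto simp: sets_unif01_iff)
  have A: "?A = X -` {a..<b} \<inter> space M"
    by auto
  have "measure M ?A = measure (distr M unif01 X) {a..<b}"
    unfolding A by (rule measure_distr[symmetric, OF X I])
  also have "\<dots> = measure lborel {a..<b}"
    using ab unfolding distr by (simp add: measure_def emeasure_unif01)
  finally have meas: "measure M ?A = b - a"
    using ab by simp
  have "tree_approx M X s U x = (\<integral>\<omega>. indicator ?A \<omega> * s (X \<omega>) \<partial>M) / (b - a)"
    unfolding tree_approx_def cell meas[symmetric]
  proof (rule cond_expectation_eq[OF M])
    show "?A \<in> sets M"
      unfolding A by (rule measurable_sets[OF X I])
    show "(\<lambda>\<omega>. s (X \<omega>)) \<in> borel_measurable M"
      by (rule measurable_compose[OF X s])
    show "measure M ?A > 0"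
      unfolding meas using ab by simp
  qed
  also have "(\<integral>\<omega>. indicator ?A \<omega> * s (X \<omega>) \<partial>M) = (\<integral>\<omega>. indicator {a..<b} (X \<omega>) * s (X \<omega>) \<partial>M)"
    by (intro Bochner_Integration.integral_cong) (auto split: split_indicator)
  also have "\<dots> = (\<integral>t. indicator {a..<b} t * s t \<partial>distr M unif01 X)"
    by (rule integral_distr[symmetric, OF X borel_measurable_times[OF borel_measurable_indicator[OF I] s]])
  finally show ?thesis
    by (simp add: distr)
qed

lemma cell_toy_partition:
  fixes k :: nat and x T :: real
  assumes k: "k \<ge> 2" and x: "x \<in> {1 / real k..1 - 1 / real k}" and T: "T \<in> {0..<1}"
  defines "r \<equiv> frac (real k * x + T)"
  shows "cell (toy_partition k T) x = {x - r / real k..<x + (1 - r) / real k}"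
proof -
  have k0: "real k > 0"
    using k by simp
  have kx: "1 \<le> real k * x" "real k * x \<le> real k - 1"
    using x k0 by (auto simp: field_simps)
  \<comment> \<open>The index of the cell that contains \<open>x\<close>.\<close>
  define i where "i = nat \<lfloor>real k * x + T\<rfloor>"
  have "1 \<le> \<lfloor>real k * x + T\<rfloor>"
    using kx T by (simp add: le_floor_iff)
  then have i: "1 \<le> i" "real i = of_int \<lfloor>real k * x + T\<rfloor>"
    unfolding i_def by linarith+
  have ir: "real k * x + T = real i + r"
    by (simp add: i r_def frac_def)
  have r: "0 \<le> r" "r < 1"
    by (auto simp: r_def frac_lt_1)
  have "real i < real k"
    using ir r kx T by auto
  then have ik: "i \<in> {1..<k}"
    using i by simp
  let ?C = "\<lambda>j::nat. {(real j - T) / real k..<(real j + 1 - T) / real k}"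
  have inC: "x \<in> ?C j \<longleftrightarrow> j = i" for j
  proof -
    have "x \<in> ?C j \<longleftrightarrow> real j \<le> real i + r \<and> real i + r < real j + 1"
      using k0 ir by (auto simp: field_simps)
    also have "\<dots> \<longleftrightarrow> j = i"
      using r by linarith
    finally show ?thesis .
  qed
  \<comment> \<open>The first and the last cell, which may be shorter, do not contain \<open>x\<close>.\<close>
  have first: "x \<notin> {0..<(1 - T) / real k}"
    using k0 kx T by (auto simp: field_simps)
  have last: "x \<notin> {(real k - T) / real k..<1}"
    using k0 ir r ik by (auto simp: field_simps)
  have "cell (toy_partition k T) x = ?C i"
    unfolding cell_def
  proof (rule the_equality)
    show "?C i \<in> toy_partition k T \<and> x \<in> ?C i"
      using ik inC[of i] unfolding toy_partition_def by blast
  next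
    fix I assume "I \<in> toy_partition k T \<and> x \<in> I"
    then obtain j where "I = ?C j" "x \<in> ?C j"
      unfolding toy_partition_def using first last by blast
    then show "I = ?C i"
      using inC[of j] by simp
  qed
  also have "(real i - T) / real k = x - r / real k"
    using k0 ir by (simp add: field_simps)
  also have "(real i + 1 - T) / real k = x + (1 - r) / real k"
    using k0 ir by (simp add: field_simps)
  finally show ?thesis .
qed

lemma toy_kernel_eq_prob:
  fixes k :: nat and x t :: real
  assumes k: "k > 0"
  shows "(\<integral>r. indicator {x - r / real k..<x + (1 - r) / real k} t \<partial>unif01) * real k
    = toy_kernel k (t - x)"
proof -
  define v where "v = real k * (t - x)"
  have k0: "real k > 0"
    using k by simp
  have iff: "t \<in> {x - r / real k..<x + (1 - r) / real k} \<longleftrightarrow> r \<in> {- v..<1 - v}" for r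
    using k0 by (auto simp: v_def field_simps)
  have "(\<integral>r. indicator {x - r / real k..<x + (1 - r) / real k} t \<partial>unif01)
      = (\<integral>r. indicator ({0..<1} \<inter> {- v..<1 - v}) r \<partial>unif01)"
    by (intro Bochner_Integration.integral_cong refl) (simp only: indicator_def iff Int_iff space_unif01 simp_thms)
  also have "\<dots> = measure unif01 ({0..<1} \<inter> {- v..<1 - v})"
    by (simp add: Int_absorb1)
  also have "\<dots> = measure lborel {max 0 (- v)..<min 1 (1 - v)}"
    by (simp add: measure_def emeasure_unif01)
  also have "\<dots> = max 0 (1 - \<bar>v\<bar>)"
    by (cases "max 0 (- v) \<le> min 1 (1 - v)") auto
  also have "\<dots> * real k = toy_kernel k (t - x)"
  proof -
    have "0 \<le> t - x \<longleftrightarrow> 0 \<le> v" "t - x \<le> 0 \<longleftrightarrow> v \<le> 0"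
      "t - x \<le> 1 / real k \<longleftrightarrow> v \<le> 1" "- (1 / real k) \<le> t - x \<longleftrightarrow> - 1 \<le> v"
      using k0 by (auto simp: v_def field_simps zero_le_mult_iff mult_le_0_iff)
    then show ?thesis
      unfolding toy_kernel_def v_def[symmetric] by (auto simp: max_def)
  qed
  finally show ?thesis .
qed

theorem proposition4:
  fixes k :: nat and M :: "'a measure" and X :: "'a \<Rightarrow> real" and s :: "real \<Rightarrow> real" and x :: real
  assumes "k \<ge> 2"
    and "prob_space M"
    and "X \<in> measurable M unif01"
    and "distr M unif01 X = unif01"
    and "integrable unif01 s"
    and "x \<in> {1 / real k..1 - 1 / real k}"
  shows "infinite_forest M X s (toy_model k) x = (LBINT t=0..1. s t * toy_kernel k (t - x))"
proof -
  have k0: "real k > 0"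
    using assms(1) by simp
  interpret U: prob_space unif01
    by (rule prob_space_unif01)
  interpret UU: pair_prob_space unif01 unif01 ..
  have s [measurable]: "s \<in> borel_measurable unif01"
    using assms(5) by auto
  have id: "(\<lambda>t. t) \<in> measurable unif01 borel"
    by (intro borel_measurable_unif01) simp
  note [measurable] = measurable_compose[OF measurable_fst id] measurable_compose[OF measurable_snd id]
  let ?J = "\<lambda>r. {x - r / real k..<x + (1 - r) / real k}"
  define g where "g r = (\<integral>t. indicator (?J r) t * s t \<partial>unif01) * real k" for r
  have tree: "tree_approx M X s (toy_partition k T) x = g (frac (real k * x + T))"
    if T: "T \<in> {0..<1}" for T
  proof -
    define r where "r = frac (real k * x + T)"
    have r: "0 \<le> r" "r < 1"
      by (auto simp: r_def frac_lt_1)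
    have "0 \<le> x - r / real k" "x - r / real k < x + (1 - r) / real k" "x + (1 - r) / real k \<le> 1"
      using assms(6) k0 r by (auto simp: field_simps)
    then have "tree_approx M X s (toy_partition k T) x
        = (\<integral>t. indicator (?J r) t * s t \<partial>unif01) / (x + (1 - r) / real k - (x - r / real k))"
      unfolding r_def
      by (intro tree_approx_eq cell_toy_partition assms(1-4,6) s T)
    also have "x + (1 - r) / real k - (x - r / real k) = 1 / real k"
      by (simp add: diff_divide_distrib)
    finally show ?thesis
      by (simp add: g_def r_def)
  qed
  have set: "{p \<in> space (unif01 \<Otimes>\<^sub>M unif01). snd p \<in> ?J (fst p)} \<in> sets (unif01 \<Otimes>\<^sub>M unif01)"
    unfolding atLeastLessThan_iff by measurable
  have J [measurable]: "(\<lambda>p. indicator (?J (fst p)) (snd p) :: real) \<in> borel_measurable (unif01 \<Otimes>\<^sub>M unif01)"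
    using borel_measurable_indicator[OF set]
    by (rule measurable_cong[THEN iffD1, rotated]) (auto simp: indicator_def)
  have "integrable (unif01 \<Otimes>\<^sub>M unif01) (\<lambda>p. s (snd p))"
  proof -
    have "integrable (distr (unif01 \<Otimes>\<^sub>M unif01) unif01 fst) s"
      using assms(5) by (simp add: U.distr_pair_fst)
    then have "integrable (unif01 \<Otimes>\<^sub>M unif01) (\<lambda>p. s (fst p))"
      by (simp add: integrable_distr_eq)
    from UU.integrable_product_swap[OF this] show ?thesis
      by (simp add: case_prod_unfold)
  qed
  then have int: "integrable (unif01 \<Otimes>\<^sub>M unif01) (\<lambda>(r, t). indicator (?J r) t * s t)"
    by (rule Bochner_Integration.integrable_bound)
       (auto simp: case_prod_beta split: split_indicator)
  have g: "g \<in> borel_measurable unif01"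
    using UU.integrable_fst[OF int] unfolding g_def by auto
  have "infinite_forest M X s (toy_model k) x = (\<integral>T. g (frac (real k * x + T)) \<partial>unif01)"
    unfolding infinite_forest_def integral_toy_model
    by (intro Bochner_Integration.integral_cong) (auto simp: tree)
  also have "\<dots> = (\<integral>r. g r \<partial>distr unif01 unif01 (\<lambda>T. frac (real k * x + T)))"
    by (rule integral_distr[symmetric, OF frac_add_measurable_unif01 g])
  also have "\<dots> = (\<integral>r. (\<integral>t. indicator (?J r) t * s t \<partial>unif01) \<partial>unif01) * real k"
    by (simp add: distr_unif01_frac_add g_def)
  also have "\<dots> = (\<integral>t. (\<integral>r. indicator (?J r) t * s t \<partial>unif01) \<partial>unif01) * real k"
    by (simp only: UU.Fubini_integral[OF int])
  also have "\<dots> = (\<integral>t. s t * ((\<integral>r. indicator (?J r) t \<partial>unif01) * real k) \<partial>unif01)"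
    by (simp add: mult_ac flip: integral_mult_left_zero)
  also have "\<dots> = (\<integral>t. s t * toy_kernel k (t - x) \<partial>unif01)"
    using assms(1) by (simp add: toy_kernel_eq_prob)
  finally show ?thesis
    by (simp add: integral_unif01)
qed

end
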